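(* For every $m\in\mathbb N=\{1,2,\dots\}$, $$C(2m,0)=(-1)^{\frac{\varphi(4m)}{2}+\varphi(2m)}\,Sy(0,-1;2m)=(-1)^{\frac{\varphi(4m)}{2}+\frac{\varphi(2m)}{2}}\,cy(2m,-1).$$
   Context: $C(n,x)$ is the minimal polynomial over $\mathbb Q$ of $2\cos(\pi/n)$. $\varphi$ is Euler's totient function. $cy(n,x)$ is the $n$-th cyclotomic polynomial (minimal polynomial of $e^{2\pi i/n}$). The cyclotomic Sylvester number used here is, for $n\ge 2$, $Sy(0,-1;n)=\prod_{1\le k\le n-1,\ \gcd(k,n)=1}(\alpha-\beta e^{2\pi i k/n})$ with $(\alpha,\beta)=(i,-i)$ (the zeros of $x^2+1$), i.e. $Sy(0,-1;n)=\prod_{1\le k\le n-1,\ \gcd(k,n)=1}\left(i+i\,e^{2\pi i k/n}\right)$. For $m=1$ the exponent $\varphi(2)/2=1/2$ is not an integer; there $(-1)^{1/2}$ is read as $i$, and all three expressions equal $0$. *)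

theory Defs
  imports
    "HOL-Analysis.Analysis"
    "HOL-Number_Theory.Totient"
    "HOL-Computational_Algebra.Computational_Algebra"
begin

definition is_rat_min_poly :: "'a :: field_char_0 \<Rightarrow> rat poly \<Rightarrow> bool" where
  "is_rat_min_poly x p \<longleftrightarrow>
     lead_coeff p = 1 \<and> poly (map_poly of_rat p) x = 0 \<and>
     (\<forall>q. q \<noteq> 0 \<longrightarrow> poly (map_poly of_rat q) x = 0 \<longrightarrow> degree p \<le> degree q)"

text \<open>Meaningful only for algebraic elements, for which \<open>is_rat_min_poly_ex1\<close> below applies.\<close>

definition rat_min_poly :: "'a :: field_char_0 \<Rightarrow> rat poly" where
  "rat_min_poly x = (THE p. is_rat_min_poly x p)"

definition cos_min_poly :: "nat \<Rightarrow> rat poly" where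
  "cos_min_poly n = rat_min_poly (2 * cos (pi / real n))"

definition cyclotomic_poly :: "nat \<Rightarrow> rat poly" where
  "cyclotomic_poly n = rat_min_poly (exp (2 * of_real pi * \<i> / of_nat n))"

text \<open>
  The cyclotomic Sylvester number is given here in terms of the zeros \<open>\<alpha>\<close>, \<open>\<beta>\<close> of the
  associated quadratic, so that Sy(0,-1;n), whose quadratic is \<open>x\<^sup>2 + 1\<close>, is
  \<open>cyclotomic_sylvester \<i> (-\<i>) n\<close>.
\<close>

definition cyclotomic_sylvester :: "complex \<Rightarrow> complex \<Rightarrow> nat \<Rightarrow> complex" where
  "cyclotomic_sylvester \<alpha> \<beta> n =
     (\<Prod>k | 1 \<le> k \<and> k \<le> n - 1 \<and> coprime k n.
        \<alpha> - \<beta> * exp (2 * of_real pi * \<i> * of_nat k / of_nat n))"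

text \<open>
  Powers of \<open>-1\<close> with a possibly half-integral exponent are taken with the principal branch
  of \<open>powr\<close>; the next two facts say that this is the usual power at natural exponents and
  reads \<open>(-1)\<close> to the power \<open>1/2\<close> as \<open>\<i>\<close>.
\<close>

lemma neg_one_powr_of_nat: "(-1 :: complex) powr of_nat k = (-1) ^ k"
  by (rule powr_nat') simp

lemma neg_one_powr_half: "(-1 :: complex) powr (1 / 2) = \<i>"
  by (simp add: flip: csqrt_conv_powr)

lemma is_rat_min_poly_unique:
  fixes x :: "'a :: field_char_0"
  assumes p: "is_rat_min_poly x p" and q: "is_rat_min_poly x q"
  shows "p = q"
proof (rule ccontr)
  assume "p \<noteq> q"
  hence nz: "p - q \<noteq> 0" by simp
  have "p \<noteq> 0" "q \<noteq> 0" using p q by (auto simp: is_rat_min_poly_def)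
  hence deg: "degree p = degree q"
    using p q unfolding is_rat_min_poly_def by (meson le_antisym)
  have "map_poly of_rat (p - q) = (map_poly of_rat p - map_poly of_rat q :: 'a poly)"
    by (rule poly_eqI) (simp add: coeff_map_poly of_rat_diff)
  hence "poly (map_poly of_rat (p - q)) x = 0"
    using p q by (simp add: is_rat_min_poly_def)
  hence le: "degree p \<le> degree (p - q)"
    using p nz by (simp add: is_rat_min_poly_def)
  have c: "coeff (p - q) (degree p) = 0"
    using p q deg by (simp add: is_rat_min_poly_def)
  have "degree (p - q) \<le> degree p"
    using deg by (simp add: degree_diff_le)
  with le have "degree (p - q) = degree p" by simp
  with c nz show False by (metis leading_coeff_0_iff)
qed

lemma is_rat_min_poly_ex1:
  fixes x :: "'a :: field_char_0"
  assumes "algebraic x"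
  shows "\<exists>!p. is_rat_min_poly x p"
proof -
  define P where "P q \<longleftrightarrow> q \<noteq> 0 \<and> poly (map_poly of_rat q) x = 0" for q :: "rat poly"
  obtain r :: "'a poly" where r: "\<And>i. coeff r i \<in> \<int>" "r \<noteq> 0" "poly r x = 0"
    using assms unfolding algebraic_def by blast
  define q0 :: "rat poly" where "q0 = map_poly (\<lambda>c. of_int (SOME z. c = of_int z)) r"
  have some0: "(SOME z. (0 :: 'a) = of_int z) = 0"
    by (rule some_equality) auto
  have "map_poly of_rat q0 = r"
  proof (rule poly_eqI)
    fix i
    obtain z where z: "coeff r i = of_int z" using r(1)[of i] by (auto elim: Ints_cases)
    have "coeff r i = of_int (SOME z. coeff r i = of_int z)" by (rule someI) (fact z)
    thus "coeff (map_poly of_rat q0) i = coeff r i"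
      by (simp add: q0_def coeff_map_poly some0 of_rat_of_int_eq)
  qed
  hence "P q0" using r by (auto simp: P_def)
  define q where "q = arg_min degree P"
  have q: "P q" and min: "\<And>s. P s \<Longrightarrow> degree q \<le> degree s"
    unfolding q_def using \<open>P q0\<close> by (auto intro: arg_min_natI arg_min_nat_le)
  define p where "p = smult (inverse (lead_coeff q)) q"
  have "map_poly of_rat p = (smult (of_rat (inverse (lead_coeff q))) (map_poly of_rat q) :: 'a poly)"
    by (rule poly_eqI) (simp add: p_def coeff_map_poly of_rat_mult)
  hence "is_rat_min_poly x p"
    using q min by (auto simp: is_rat_min_poly_def P_def p_def)
  thus ?thesis using is_rat_min_poly_unique by blast
qed

end

theory Submission
  imports Defs
begin

text \<open>
  The minimal polynomial of an algebraic number is the product of \<open>X - z\<close> over its conjugates \<open>z\<close>.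
  That the conjugates of a primitive \<open>n\<close>-th root of unity are all primitive \<open>n\<close>-th roots of unity
  is Landau's argument: if \<open>f\<close> is its integral minimal polynomial, then \<open>f(X\<^sup>p)\<close> and \<open>f(X)\<^sup>p\<close> agree
  modulo \<open>p\<close>, so \<open>f\<close> divides \<open>f(X\<^sup>p)\<close> for all large primes \<open>p\<close>, and every residue class coprime to
  \<open>n\<close> contains a number all of whose prime factors are large. Writing
  \<open>2 cos (\<pi> / n) = \<omega> + 1 / \<omega>\<close> with a primitive \<open>2n\<close>-th root of unity \<open>\<omega>\<close> gives the conjugates
  \<open>2 cos (\<pi> k / n)\<close> with \<open>k < n\<close> coprime to \<open>2n\<close>. For even \<open>n\<close> the three values then agree up to
  phases, which are collected with \<open>\<phi>(2n) = 2 \<phi>(n)\<close>.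
\<close>

section \<open>Coefficient maps\<close>

lemma map_poly_add_hom:
  assumes "f 0 = 0" "\<And>a b. f (a + b) = f a + f b"
  shows "map_poly f (p + q) = map_poly f p + map_poly f q"
  by (rule poly_eqI) (simp add: coeff_map_poly assms)

lemma map_poly_mult_hom:
  fixes f :: "'a :: comm_semiring_0 \<Rightarrow> 'b :: comm_semiring_0"
  assumes "f 0 = 0" "\<And>a b. f (a + b) = f a + f b" "\<And>a b. f (a * b) = f a * f b"
  shows "map_poly f (p * q) = map_poly f p * map_poly f q"
proof (induction p)
  case 0
  then show ?case by simp
next
  case (pCons a p)
  have "map_poly f (smult a q) = smult (f a) (map_poly f q)"
    by (rule poly_eqI) (simp add: coeff_map_poly assms)
  with pCons show ?case
    by (simp add: map_poly_pCons assms map_poly_add_hom)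
qed

lemmas map_poly_of_rat_mult = map_poly_mult_hom[OF of_rat_0 of_rat_add of_rat_mult]

lemmas map_poly_of_int_mult = map_poly_mult_hom[OF of_int_0 of_int_add of_int_mult]

lemma map_poly_of_rat_add:
  "map_poly of_rat (p + q) = (map_poly of_rat p + map_poly of_rat q :: 'a :: field_char_0 poly)"
  by (rule map_poly_add_hom) (simp_all add: of_rat_add)

lemma map_poly_of_rat_diff:
  "map_poly of_rat (p - q) = (map_poly of_rat p - map_poly of_rat q :: 'a :: field_char_0 poly)"
  by (rule poly_eqI) (simp add: coeff_map_poly of_rat_diff)

lemma map_poly_of_rat_of_int:
  "map_poly of_rat (map_poly of_int p) = (map_poly of_int p :: 'a :: field_char_0 poly)"
  by (rule poly_eqI) (simp add: coeff_map_poly)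

lemma poly_of_rat_of_rat:
  "poly (map_poly of_rat p) (of_rat x) = (of_rat (poly p x) :: 'a :: field_char_0)"
  by (induction p) (simp_all add: map_poly_pCons of_rat_add of_rat_mult)

lemma of_real_of_rat: "of_real (of_rat a) = (of_rat a :: complex)"
proof (cases a)
  case (Fract u v)
  then show ?thesis by (simp add: of_rat_rat)
qed

lemma poly_of_rat_of_real:
  "poly (map_poly of_rat p) (of_real x) = (of_real (poly (map_poly of_rat p) x) :: complex)"
  by (induction p) (simp_all add: map_poly_pCons of_real_of_rat)

section \<open>Minimal polynomials\<close>

text \<open>The remainder modulo \<open>p\<close> again vanishes at \<open>x\<close> and has smaller
  degree. Monicity is left out so that the lemma applies to an unnormalised polynomial of least
  degree.\<close>

lemma min_degree_root_dvd:
  fixes x :: "'a :: field_char_0"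
  assumes p: "p \<noteq> 0" "poly (map_poly of_rat p) x = 0"
    and min: "\<And>q. q \<noteq> 0 \<Longrightarrow> poly (map_poly of_rat q) x = 0 \<Longrightarrow> degree p \<le> degree q"
    and q: "poly (map_poly of_rat q) x = 0"
  shows "p dvd q"
proof (rule ccontr)
  assume "\<not> p dvd q"
  hence nz: "q mod p \<noteq> 0" by (simp add: dvd_eq_mod_eq_0)
  have "map_poly of_rat q = (map_poly of_rat (q div p) * map_poly of_rat p + map_poly of_rat (q mod p) :: 'a poly)"
    by (simp flip: map_poly_of_rat_mult map_poly_of_rat_add)
  hence "poly (map_poly of_rat (q mod p)) x = 0"
    using p q by simp
  from min[OF nz this] have "degree p \<le> degree (q mod p)" .
  moreover have "degree (q mod p) < degree p"
    using nz p(1) degree_mod_less by blast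
  ultimately show False by simp
qed

lemma is_rat_min_poly_dvd:
  assumes "is_rat_min_poly x p" "poly (map_poly of_rat q) x = 0"
  shows "p dvd q"
  using assms by (intro min_degree_root_dvd[of p x q]) (auto simp: is_rat_min_poly_def)

lemma poly_of_rat_dvd:
  assumes "p dvd q" "poly (map_poly of_rat p) (y :: 'a :: field_char_0) = 0"
  shows "poly (map_poly of_rat q) y = 0"
  using assms by (auto simp: dvd_def map_poly_of_rat_mult)

text \<open>Minimal polynomials are irreducible: for \<open>q\<close> of least degree with root
  \<open>y\<close> and \<open>p = q * h\<close>, the number \<open>x\<close> is a root of
  \<open>q\<close> or \<open>h\<close>, and minimality at \<open>x\<close> leaves only
  \<open>q\<close>, with full degree. Allowing \<open>y\<close> in another field lets the real
  cosine be moved into the complex numbers.\<close>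

lemma is_rat_min_poly_root:
  fixes x :: "'a :: field_char_0" and y :: "'b :: field_char_0"
  assumes p: "is_rat_min_poly x p" and y: "poly (map_poly of_rat p) y = 0"
  shows "is_rat_min_poly y p"
proof -
  define P where "P q \<longleftrightarrow> q \<noteq> 0 \<and> poly (map_poly of_rat q) y = 0" for q :: "rat poly"
  have p0: "p \<noteq> 0" using p by (auto simp: is_rat_min_poly_def)
  hence "P p" using y by (simp add: P_def)
  define q where "q = arg_min degree P"
  have q: "P q" and min: "\<And>s. P s \<Longrightarrow> degree q \<le> degree s"
    unfolding q_def using \<open>P p\<close> by (auto intro: arg_min_natI arg_min_nat_le)
  have "q dvd p"
    using q min y by (intro min_degree_root_dvd[of q y p]) (auto simp: P_def)
  then obtain h where h: "p = q * h" by (auto simp: dvd_def)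
  hence h0: "h \<noteq> 0" "q \<noteq> 0" using p0 by auto
  have dq: "degree q > 0"
  proof (rule Nat.gr0I)
    assume "degree q = 0"
    then obtain c where "q = [:c:]" by (auto elim: degree_eq_zeroE)
    thus False using q by (auto simp: P_def map_poly_pCons)
  qed
  have deg: "degree p = degree q + degree h"
    using h h0 by (simp add: degree_mult_eq)
  have "poly (map_poly of_rat q) x = 0 \<or> poly (map_poly of_rat h) x = 0"
    using p h by (simp add: is_rat_min_poly_def map_poly_of_rat_mult)
  hence "degree p \<le> degree q"
    using p h0 dq deg unfolding is_rat_min_poly_def by fastforce
  thus ?thesis
    using p y min unfolding is_rat_min_poly_def P_def by (meson le_trans)
qed

lemma is_rat_min_poly_rat_min_poly:
  fixes x :: "'a :: field_char_0"
  assumes "q \<noteq> 0" "poly (map_poly of_rat q) x = 0"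
  shows "is_rat_min_poly x (rat_min_poly x)"
proof -
  define P where "P q \<longleftrightarrow> q \<noteq> 0 \<and> poly (map_poly of_rat q) x = 0" for q :: "rat poly"
  define r where "r = arg_min degree P"
  have "P q" using assms by (simp add: P_def)
  hence r: "P r" and min: "\<And>s. P s \<Longrightarrow> degree r \<le> degree s"
    unfolding r_def by (auto intro: arg_min_natI arg_min_nat_le)
  define p where "p = smult (inverse (lead_coeff r)) r"
  have "map_poly of_rat p = (smult (of_rat (inverse (lead_coeff r))) (map_poly of_rat r) :: 'a poly)"
    by (rule poly_eqI) (simp add: p_def coeff_map_poly of_rat_mult)
  hence "is_rat_min_poly x p"
    using r min by (auto simp: is_rat_min_poly_def P_def p_def)
  thus ?thesis
    unfolding rat_min_poly_def by (rule theI) (auto intro: is_rat_min_poly_unique \<open>is_rat_min_poly x p\<close>)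
qed

text \<open>All roots are simple: \<open>p\<close> is also the minimal polynomial of each of its
  roots, so its derivative, of smaller degree, cannot share one.\<close>

lemma is_rat_min_poly_prod_roots:
  assumes p: "is_rat_min_poly x p"
  shows "map_poly of_rat p = (\<Prod>z | poly (map_poly of_rat p) z = 0. [:-z, 1:] :: complex poly)"
proof -
  define P where "P = (map_poly of_rat p :: complex poly)"
  have p0: "p \<noteq> 0" using p by (auto simp: is_rat_min_poly_def)
  have "rsquarefree P"
    unfolding rsquarefree_roots
  proof (intro allI notI)
    fix a assume a: "poly P a = 0 \<and> poly (pderiv P) a = 0"
    hence min: "is_rat_min_poly a p"
      using p by (auto simp: P_def intro: is_rat_min_poly_root)
    have "pderiv P = map_poly of_rat (pderiv p)"
      unfolding P_def by (rule poly_eqI) (simp add: coeff_map_poly coeff_pderiv of_rat_mult of_rat_add)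
    hence root: "poly (map_poly of_rat (pderiv p)) a = 0" using a by simp
    have "degree p > 0"
    proof (rule Nat.gr0I)
      assume "degree p = 0"
      then obtain c where "p = [:c:]" by (auto elim: degree_eq_zeroE)
      thus False using a p0 by (auto simp: P_def map_poly_pCons)
    qed
    moreover from this have "pderiv p \<noteq> 0" by (simp add: pderiv_eq_0_iff)
    ultimately show False
      using min root unfolding is_rat_min_poly_def by (auto simp: degree_pderiv)
  qed
  from complex_poly_decompose_rsquarefree[OF this] show ?thesis
    using p by (simp add: P_def is_rat_min_poly_def lead_coeff_map_poly_nz)
qed

section \<open>Monic integral factors\<close>

lemma rat_poly_clear_denominators:
  fixes p :: "rat poly"
  obtains d :: int and G :: "int poly" where "d > 0" "smult (of_int d) p = map_poly of_int G"
proof -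
  have "\<exists>d G. d > 0 \<and> smult (of_int d) p = map_poly of_int G"
  proof (induction p)
    case 0
    show ?case by (intro exI[of _ 1] exI[of _ 0]) simp
  next
    case (pCons a p)
    then obtain d G where d: "d > 0" "smult (of_int d) p = map_poly of_int G" by blast
    obtain u v where uv: "v > 0" "a = of_int u / of_int v"
      by (metis quotient_of_denom_pos quotient_of_div surj_pair)
    have "smult (of_int (d * v)) (pCons a p) = pCons (of_int (d * u)) (smult (of_int v) (smult (of_int d) p))"
      using uv by (simp add: mult.commute)
    also have "\<dots> = map_poly of_int (pCons (d * u) (smult v G))"
      unfolding d(2) by (simp add: map_poly_pCons map_poly_smult)
    finally show ?case using d(1) uv(1) by (intro exI[of _ "d * v"] exI) auto
  qed
  thus ?thesis using that by blast
qed

lemma rat_poly_content_1: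
  fixes p :: "rat poly"
  assumes "p \<noteq> 0"
  obtains c :: rat and F :: "int poly" where "p = smult c (map_poly of_int F)" "content F = 1"
proof -
  obtain d :: int and G where d: "d > 0" "smult (of_int d) p = map_poly of_int G"
    by (rule rat_poly_clear_denominators)
  have "G \<noteq> 0" using d assms by auto
  have "map_poly of_int G = smult (of_int (content G)) (map_poly of_int (primitive_part G) :: rat poly)"
    by (subst content_times_primitive_part[of G, symmetric], subst map_poly_smult) auto
  hence "smult (of_int d) p = smult (of_int (content G)) (map_poly of_int (primitive_part G))"
    using d by simp
  hence "smult (inverse (of_int d)) (smult (of_int d) p) =
     smult (inverse (of_int d)) (smult (of_int (content G)) (map_poly of_int (primitive_part G)))"
    by simp
  hence "p = smult (of_int (content G) / of_int d) (map_poly of_int (primitive_part G))"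
    using d(1) by (simp add: field_simps)
  thus ?thesis using that \<open>G \<noteq> 0\<close> by (simp add: content_primitive_part)
qed

text \<open>Gauss's lemma. With \<open>p\<close> and \<open>g\<close> written as rational multiples
  of primitive \<open>F\<close> and \<open>G\<close>, comparing contents gives \<open>R\<close> =
  +-\<open>F * G\<close>. Hence the leading coefficient of \<open>F\<close> is a unit, and
  \<open>p\<close> is \<open>F\<close> up to sign.\<close>

lemma monic_rat_factor_integral:
  fixes p g :: "rat poly" and R :: "int poly"
  assumes p: "lead_coeff p = 1" and R: "lead_coeff R = 1" and eq: "map_poly of_int R = p * g"
  obtains P where "p = map_poly of_int P" "lead_coeff P = 1" "P dvd R"
proof -
  have cR: "content R = 1"
    using content_dvd_coeff[of R "degree R"] R by (metis is_unit_content_iff)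
  have "R \<noteq> 0" using R by auto
  hence "p * g \<noteq> 0" unfolding eq[symmetric] by (simp add: map_poly_eq_0_iff)
  hence "p \<noteq> 0" "g \<noteq> 0" by auto
  obtain c F where F: "p = smult c (map_poly of_int F)" "content F = 1"
    using rat_poly_content_1[OF \<open>p \<noteq> 0\<close>] .
  obtain c' G where G: "g = smult c' (map_poly of_int G)" "content G = 1"
    using rat_poly_content_1[OF \<open>g \<noteq> 0\<close>] .
  obtain a b where ab: "b > 0" "c * c' = of_int a / of_int b"
    by (metis quotient_of_denom_pos quotient_of_div surj_pair)
  have "map_poly of_int (smult b R) = (smult (of_int b) (map_poly of_int R) :: rat poly)"
    by (simp add: map_poly_smult)
  also have "\<dots> = smult (of_int b * (c * c')) (map_poly of_int (F * G))"
    unfolding eq F G map_poly_of_int_mult by (simp add: ac_simps)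
  also have "of_int b * (c * c') = of_int a" using ab by simp
  also have "smult (of_int a) (map_poly of_int (F * G)) = (map_poly of_int (smult a (F * G)) :: rat poly)"
    by (subst map_poly_smult) auto
  finally have "smult b R = smult a (F * G)"
    by (simp add: poly_eq_iff coeff_map_poly del: coeff_smult)
  moreover from arg_cong[OF this, of content] have "\<bar>b\<bar> = \<bar>a\<bar>"
    using cR F G by (simp add: content_mult)
  ultimately have RFG: "R = F * G \<or> R = - (F * G)"
  proof -
    assume eq: "smult b R = smult a (F * G)" and "\<bar>b\<bar> = \<bar>a\<bar>"
    hence "a = b \<or> a = - b" by arith
    hence "smult b (R - F * G) = 0 \<or> smult b (R + F * G) = 0"
      using eq by (auto simp: smult_diff_right smult_add_right)
    hence "R - F * G = 0 \<or> R + F * G = 0" using ab(1) by simp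
    thus ?thesis by (auto simp: eq_neg_iff_add_eq_0)
  qed
  hence "lead_coeff F dvd 1"
  proof -
    have "lead_coeff R = lead_coeff F * lead_coeff G \<or> lead_coeff R = - (lead_coeff F * lead_coeff G)"
      using RFG by (auto simp: lead_coeff_mult lead_coeff_minus)
    thus ?thesis using R by (metis dvd_minus_iff dvd_triv_left)
  qed
  hence l: "lead_coeff F * lead_coeff F = 1" "lead_coeff F = 1 \<or> lead_coeff F = -1"
    by (auto simp: zdvd1_eq abs_if split: if_splits)
  have "lead_coeff p = c * of_int (lead_coeff F)"
    unfolding F(1) by (simp add: degree_map_poly coeff_map_poly)
  hence c: "c = of_int (lead_coeff F)" using p l(2) by auto
  show ?thesis
  proof
    show "p = map_poly of_int (smult (lead_coeff F) F)"
      using F(1) c by (simp add: map_poly_smult)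
    show "lead_coeff (smult (lead_coeff F) F) = 1" using l(2) by auto
    show "smult (lead_coeff F) F dvd R"
      using RFG l(2) by auto
  qed
qed

section \<open>Conjugates of roots of unity\<close>

lemma prime_dvd_freshmans_dream:
  fixes x y :: "'a :: comm_ring_1"
  assumes "prime p"
  shows "of_nat p dvd (x + y) ^ p - (x ^ p + y ^ p)"
proof -
  have p: "p > 0" using assms by (simp add: prime_gt_0_nat)
  define f where "f k = of_nat (p choose k) * x ^ k * y ^ (p - k)" for k
  have "(x + y) ^ p = (\<Sum>k\<le>p. f k)"
    unfolding f_def by (rule binomial_ring)
  also have "{..p} = insert 0 (insert p {0<..<p})" using p by auto
  also have "(\<Sum>k\<in>\<dots>. f k) = f 0 + (f p + (\<Sum>k\<in>{0<..<p}. f k))"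
    using p by (subst sum.insert, simp, simp, subst sum.insert) auto
  finally have "(x + y) ^ p - (x ^ p + y ^ p) = (\<Sum>k\<in>{0<..<p}. f k)"
    by (simp add: f_def)
  moreover have "of_nat p dvd (\<Sum>k\<in>{0<..<p}. f k)"
  proof (rule dvd_sum)
    fix k assume k: "k \<in> {0<..<p}"
    have "p dvd (p choose k)"
      by (rule dvd_choose_prime) (use k assms in auto)
    hence "(of_nat p :: 'a) dvd of_nat (p choose k)" by (auto simp: dvd_def)
    thus "of_nat p dvd f k" by (simp add: f_def mult.assoc)
  qed
  ultimately show ?thesis by simp
qed

lemma prime_dvd_power_diff_self_int:
  fixes a :: int
  assumes "prime (p :: nat)"
  shows "int p dvd a ^ p - a"
proof -
  have nat: "int p dvd int n ^ p - int n" for n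
  proof (induction n)
    case 0
    then show ?case using prime_gt_0_nat[OF assms] by (simp add: zero_power)
  next
    case (Suc n)
    have "int p dvd ((int n + 1) ^ p - (int n ^ p + 1 ^ p)) + (int n ^ p - int n)"
      using prime_dvd_freshmans_dream[OF assms, of "int n" 1] Suc.IH by (intro dvd_add) auto
    then show ?case by (simp add: algebra_simps)
  qed
  define b where "b = a mod int p"
  have p: "p > 0" using assms by (simp add: prime_gt_0_nat)
  have "int p dvd b ^ p - b"
    using nat[of "nat b"] p by (simp add: b_def)
  moreover have "(a ^ p - a) mod int p = (b ^ p - b) mod int p"
    unfolding b_def by (intro mod_diff_cong) (simp_all add: power_mod)
  ultimately show ?thesis by (simp add: dvd_eq_mod_eq_0)
qed

text \<open>Induction on the coefficients: the freshman's dream splits the power of a + X f,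
  Fermat's little theorem replaces a^p by a, and (X f)^p is X^p f^p.\<close>

lemma prime_dvd_pcompose_power_diff:
  fixes f :: "int poly"
  assumes p: "prime p"
  shows "of_nat p dvd pcompose f (monom 1 p) - f ^ p"
proof (induction f)
  case 0
  then show ?case using p by (simp add: prime_gt_0_nat power_0_left)
next
  case (pCons a f)
  let ?X = "monom 1 1 :: int poly"
  have split: "pCons a f = [:a:] + ?X * f"
    by (simp add: monom_altdef)
  have Xp: "(?X * f) ^ p = monom 1 p * f ^ p"
    by (simp add: power_mult_distrib monom_power)
  have ap: "[:a:] ^ p = [:a ^ p:]" by (simp add: poly_const_pow)
  obtain c where c: "a ^ p - a = int p * c"
    using prime_dvd_power_diff_self_int[OF p, of a] by (auto simp: dvd_def)
  have "[:a:] - [:a ^ p:] = of_nat p * [:-c:]"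
    using c by (simp add: of_nat_poly algebra_simps)
  hence d1: "of_nat p dvd [:a:] - [:a:] ^ p" unfolding ap by (metis dvd_triv_left)
  have d2: "of_nat p dvd monom 1 p * (pcompose f (monom 1 p) - f ^ p)"
    using pCons.IH by (rule dvd_mult)
  have d3: "of_nat p dvd (pCons a f) ^ p - ([:a:] ^ p + (?X * f) ^ p)"
    unfolding split by (rule prime_dvd_freshmans_dream[OF p])
  have "pcompose (pCons a f) (monom 1 p) - (pCons a f) ^ p =
     ([:a:] - [:a:] ^ p) + monom 1 p * (pcompose f (monom 1 p) - f ^ p) -
     ((pCons a f) ^ p - ([:a:] ^ p + (?X * f) ^ p))"
    unfolding Xp by (simp add: pcompose_pCons algebra_simps)
  thus ?case using d1 d2 d3 by (metis dvd_add dvd_diff)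
qed

text \<open>Pseudo-division scales the dividend by a power of the divisor's leading coefficient; for
  a monic divisor this is genuine division, also over the integers.\<close>

lemma monic_division:
  fixes f g :: "'a :: idom poly"
  assumes "lead_coeff g = 1"
  obtains q r where "f = g * q + r" "r = 0 \<or> degree r < degree g"
proof -
  obtain q r where qr: "pseudo_divmod f g = (q, r)" by force
  have "g \<noteq> 0" using assms by auto
  from pseudo_divmod[OF this qr] show ?thesis using that assms by simp
qed

lemma diff_dvd_power_diff: "(a - b :: 'a :: comm_ring_1) dvd a ^ n - b ^ n"
  by (metis dvd_triv_left power_diff_sumr2)

lemma diff_dvd_pcompose_diff:
  fixes f :: "'a :: comm_ring_1 poly"
  shows "a - b dvd pcompose f a - pcompose f b"
proof (induction f)
  case (pCons c f)
  have "pcompose (pCons c f) a - pcompose (pCons c f) b =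
     (a - b) * pcompose f a + b * (pcompose f a - pcompose f b)"
    by (simp add: pcompose_pCons algebra_simps)
  thus ?case using pCons.IH by simp
qed simp

lemma monom_diff_dvd:
  assumes "j \<le> i" "i mod n = j mod n"
  shows "(monom 1 n - 1 :: 'a :: comm_ring_1 poly) dvd monom 1 i - monom 1 j"
proof -
  obtain t where t: "i = j + n * t"
    using assms by (metis mod_eq_nat1E)
  have "monom 1 n - 1 dvd (monom 1 n) ^ t - (1 :: 'a poly) ^ t"
    by (rule diff_dvd_power_diff)
  hence "monom 1 n - 1 dvd monom 1 j * ((monom 1 n) ^ t - (1 :: 'a poly))"
    by simp
  also have "monom 1 j * ((monom 1 n) ^ t - (1 :: 'a poly)) = monom 1 i - monom 1 j"
    by (simp add: t monom_power mult_monom algebra_simps)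
  finally show ?thesis .
qed

text \<open>
  Modulo \<open>f\<close>, the polynomial \<open>f(X\<^sup>p)\<close> depends only on \<open>p mod n\<close>, while it is congruent to \<open>f\<^sup>p = 0\<close>
  modulo \<open>p\<close>. One of finitely many remainders that is divisible by arbitrarily large \<open>p\<close> vanishes.
\<close>

lemma large_prime_pcompose_dvd:
  fixes f :: "int poly"
  assumes monic: "lead_coeff f = 1" and dvd: "f dvd monom 1 n - 1" and n: "n > 0"
  obtains A where "\<And>p. prime p \<Longrightarrow> p > A \<Longrightarrow> f dvd pcompose f (monom 1 p)"
proof -
  have "\<forall>j. \<exists>q r. pcompose f (monom 1 j) = f * q + r \<and> (r = 0 \<or> degree r < degree f)"
    using monic_division[OF monic] by metis
  then obtain q r where qr: "\<And>j. pcompose f (monom 1 j) = f * q j + r j"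
      "\<And>j. r j = 0 \<or> degree (r j) < degree f"
    by metis
  \<comment> \<open>\<open>A\<close> bounds the coefficients of all remainders \<open>r j\<close>
    with \<open>j < n\<close>, hence of every remainder that can occur.\<close>
  define A where "A = Max (insert 0 ((\<lambda>(j, i). nat \<bar>coeff (r j) i\<bar>) ` ({..<n} \<times> {..degree f})))"
  have A: "\<bar>coeff (r j) i\<bar> \<le> int A" if "j < n" for i j
  proof (cases "i \<le> degree f")
    case True
    hence "nat \<bar>coeff (r j) i\<bar> \<le> A"
      unfolding A_def using that by (intro Max_ge) auto
    thus ?thesis by simp
  next
    case False
    hence "coeff (r j) i = 0" using qr(2)[of j] by (auto intro: coeff_eq_0)
    thus ?thesis by simp
  qed
  show ?thesis
  proof
    fix p :: nat assume p: "prime p" "p > A"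
    define j where "j = p mod n"
    have jn: "j < n" using n by (simp add: j_def)
    have "j \<le> p" "p mod n = j mod n" by (simp_all add: j_def)
    hence "f dvd monom 1 p - monom 1 j"
      using dvd monom_diff_dvd dvd_trans by blast
    hence c1: "f dvd pcompose f (monom 1 p) - pcompose f (monom 1 j)"
      using diff_dvd_pcompose_diff dvd_trans by blast
    obtain h where h: "pcompose f (monom 1 p) - f ^ p = of_nat p * h"
      using prime_dvd_pcompose_power_diff[OF p(1), of f] by (auto simp: dvd_def)
    obtain s t where st: "h = f * s + t" "t = 0 \<or> degree t < degree f"
      using monic_division[OF monic] .
    have "f dvd f ^ p" using p(1) by (simp add: prime_gt_0_nat)
    \<comment> \<open>The multiples of \<open>f\<close> are arranged so that only
      \<open>r j - of_nat p * t\<close> is left. Its degree is too small for a nonzero multiple of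
      \<open>f\<close>, so \<open>p\<close> divides every coefficient of \<open>r j\<close>,
      although these are smaller than \<open>p\<close>.\<close>
    hence "f dvd f ^ p + of_nat p * (f * s) - f * q j - (pcompose f (monom 1 p) - pcompose f (monom 1 j))"
      by (intro dvd_diff[OF dvd_diff[OF dvd_add] c1]) auto
    also have "\<dots> = r j - of_nat p * t"
      using h qr(1)[of j] st(1) by (simp add: algebra_simps)
    finally have "f dvd r j - smult (int p) t" by (simp add: of_nat_poly)
    moreover have "r j - smult (int p) t = 0 \<or> degree (r j - smult (int p) t) < degree f"
    proof (cases "degree f = 0")
      case True
      thus ?thesis using qr(2)[of j] st(2) by auto
    next
      case False
      hence "degree (r j) < degree f" "degree (smult (int p) t) < degree f"
        using qr(2)[of j] st(2) degree_smult_le[of "int p" t] by auto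
      thus ?thesis by (simp add: degree_diff_less)
    qed
    ultimately have "r j - smult (int p) t = 0"
      using dvd_imp_degree_le not_le by blast
    hence eq: "r j = smult (int p) t" by simp
    have "r j = 0"
    proof (rule poly_eqI)
      fix i
      have "int p dvd coeff (r j) i" by (simp add: eq)
      moreover have "\<bar>coeff (r j) i\<bar> < int p" using A[OF jn, of i] p(2) by simp
      ultimately show "coeff (r j) i = coeff 0 i"
        by (metis coeff_0 dvd_imp_le_int not_le abs_of_nat)
    qed
    hence "f dvd pcompose f (monom 1 j)" using qr(1)[of j] by simp
    from dvd_add[OF c1 this] show "f dvd pcompose f (monom 1 p)" by simp
  qed
qed

text \<open>Each prime up to \<open>A\<close> divides exactly one of \<open>k\<close> and
  \<open>n * t\<close> when \<open>t\<close> is the product of those not dividing \<open>k\<close>,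
  hence never their sum. This elementary choice replaces Dirichlet's theorem on primes in
  progressions.\<close>

lemma coprime_shift_large_prime_factors:
  fixes k n A :: nat
  assumes "coprime k n"
  obtains t where "\<And>q. prime q \<Longrightarrow> q dvd k + n * t \<Longrightarrow> q > A"
proof
  define t where "t = \<Prod>{q. prime q \<and> q \<le> A \<and> \<not> q dvd k}"
  fix q :: nat assume q: "prime q" "q dvd k + n * t"
  show "q > A"
  proof (rule ccontr)
    assume "\<not> q > A"
    have fin: "finite {q. prime q \<and> q \<le> A \<and> \<not> q dvd k}" by (rule finite_subset[of _ "{..A}"]) auto
    show False
    proof (cases "q dvd k")
      case True
      hence "q dvd n * t" using q(2) by (simp add: dvd_add_right_iff)
      moreover have "\<not> q dvd n"
        using True assms q(1) by (meson coprime_common_divisor_nat not_prime_1 coprime_def not_prime_unit)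
      ultimately have "q dvd t" using q(1) by (simp add: prime_dvd_mult_iff)
      then obtain q' where "prime q'" "\<not> q' dvd k" "q dvd q'"
        unfolding t_def using q(1) fin by (auto simp: prime_dvd_prod_iff)
      thus False using True primes_dvd_imp_eq[OF q(1)] by blast
    next
      case False
      hence "q dvd t" unfolding t_def using q(1) \<open>\<not> q > A\<close> fin by (intro dvd_prodI) auto
      hence "q dvd k" using q(2) by (simp add: dvd_add_left_iff)
      thus False using False by simp
    qed
  qed
qed

lemma poly_of_int_pcompose_monom:
  "poly (map_poly of_int (pcompose f (monom 1 m))) w =
     poly (map_poly of_int f) (w ^ m :: 'a :: field_char_0)"
proof (induction f)
  case (pCons a f)
  have "map_poly of_int (pcompose (pCons a f) (monom 1 m)) =
      ([:of_int a:] + monom 1 m * map_poly of_int (pcompose f (monom 1 m)) :: 'a poly)"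
    by (simp add: pcompose_pCons map_poly_add_hom map_poly_of_int_mult map_poly_pCons map_poly_monom)
  thus ?case using pCons.IH by (simp add: map_poly_pCons poly_monom)
qed simp

lemma poly_of_rat_pcompose:
  "poly (map_poly of_rat (pcompose f g)) w =
     poly (map_poly of_rat f) (poly (map_poly of_rat g) w :: 'a :: field_char_0)"
proof (induction f)
  case (pCons a f)
  have "map_poly of_rat (pcompose (pCons a f) g) =
      ([:of_rat a:] + map_poly of_rat g * map_poly of_rat (pcompose f g) :: 'a poly)"
    by (simp add: pcompose_pCons map_poly_of_rat_add map_poly_of_rat_mult map_poly_pCons)
  thus ?case using pCons.IH by (simp add: map_poly_pCons)
qed simp

text \<open>Since w^n = 1, \<open>k\<close> may be shifted by a multiple of \<open>n\<close> until
  all its prime factors exceed \<open>A\<close>. The power is then taken one prime at a time, each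
  step staying among the roots of \<open>f\<close>.\<close>

lemma int_factor_root_power:
  fixes w :: "'a :: field_char_0" and f :: "int poly"
  assumes monic: "lead_coeff f = 1" and dvd: "f dvd monom 1 n - 1" and n: "n > 0"
    and root: "poly (map_poly of_int f) w = 0" and k: "coprime k n"
  shows "poly (map_poly of_int f) (w ^ k) = 0"
proof -
  have dvd_root: "poly (map_poly of_int g) v = 0"
    if "f dvd g" "poly (map_poly of_int f) v = 0" for g and v :: 'a
    using that by (auto simp: dvd_def map_poly_of_int_mult)
  obtain A where A: "\<And>p. prime p \<Longrightarrow> p > A \<Longrightarrow> f dvd pcompose f (monom 1 p)"
    using large_prime_pcompose_dvd[OF monic dvd n] by blast
  have step: "poly (map_poly of_int f) (v ^ m) = 0"
    if "m > 0" "\<And>q. prime q \<Longrightarrow> q dvd m \<Longrightarrow> q > A" "poly (map_poly of_int f) v = 0" for m and v :: 'a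
    using that
  proof (induction m arbitrary: v rule: less_induct)
    case (less m)
    show ?case
    proof (cases "m = 1")
      case True
      then show ?thesis using less.prems by simp
    next
      case False
      then obtain q where q: "prime q" "q dvd m" using prime_factor_nat by blast
      then obtain l where l: "m = q * l" by (auto simp: dvd_def)
      have "f dvd pcompose f (monom 1 q)" using A less.prems(2) q by blast
      hence "poly (map_poly of_int f) (v ^ q) = 0"
        using dvd_root[of "pcompose f (monom 1 q)" v] less.prems(3)
        by (simp add: poly_of_int_pcompose_monom)
      moreover have "l > 0" "l < m" using l less.prems(1) prime_gt_1_nat[OF q(1)] by auto
      ultimately have "poly (map_poly of_int f) ((v ^ q) ^ l) = 0"
        using less.prems(2) l by (intro less.IH[of l "v ^ q"]) auto
      thus ?thesis by (simp add: l power_mult)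
    qed
  qed
  have "poly (map_poly of_int (monom 1 n - 1)) w = 0"
    using dvd_root[OF dvd root] .
  moreover have "map_poly of_int (monom 1 n - 1) = (monom 1 n - 1 :: 'a poly)"
    by (rule poly_eqI) (simp add: coeff_map_poly)
  ultimately have wn: "w ^ n = 1" by (simp add: poly_monom)
  obtain t where t: "\<And>q. prime q \<Longrightarrow> q dvd k + n * t \<Longrightarrow> q > A"
    using coprime_shift_large_prime_factors[OF k] by blast
  have pow: "w ^ (k + n * t) = w ^ k" by (simp add: power_add power_mult wn)
  show ?thesis
  proof (cases "k + n * t = 0")
    \<comment> \<open>\<open>step\<close> needs a positive exponent. A zero exponent forces
      \<open>k = 0\<close>, so coprimality gives \<open>n = 1\<close> and thus \<open>w\<close> =
      1.\<close>
    case True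
    have "k = 0" "n = 1" using True k by auto
    thus ?thesis using root wn by simp
  next
    case False
    with step[of "k + n * t" w] t root show ?thesis unfolding pow by simp
  qed
qed

text \<open>The minimal polynomial of \<open>x\<close> divides X^n - 1, so it is integral by Gauss's
  lemma and the integral result applies. Arbitrary \<open>q\<close> is allowed because a composed
  polynomial is substituted later.\<close>

lemma root_of_unity_power_conjugate:
  fixes x :: "'a :: field_char_0"
  assumes x: "x ^ n = 1" and n: "n > 0" and q: "poly (map_poly of_rat q) x = 0"
    and k: "coprime k n"
  shows "poly (map_poly of_rat q) (x ^ k) = 0"
proof -
  define p where "p = rat_min_poly x"
  define R where "R = (monom 1 n - 1 :: int poly)"
  have deg: "degree R = n" "lead_coeff R = 1"
  proof -
    show "degree R = n"
      using degree_add_eq_left[of "-1" "monom 1 n :: int poly"] n by (simp add: R_def degree_monom_eq)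
    thus "lead_coeff R = 1" using n by (simp add: R_def)
  qed
  have mapR: "map_poly of_rat (map_poly of_int R) = (monom 1 n - 1 :: 'a poly)"
    unfolding map_poly_of_rat_of_int R_def by (rule poly_eqI) (simp add: coeff_map_poly)
  have rootR: "poly (map_poly of_rat (map_poly of_int R)) x = 0"
    unfolding mapR using x by (simp add: poly_monom)
  have "map_poly of_int R \<noteq> (0 :: rat poly)"
    using deg by (subst map_poly_eq_0_iff) auto
  hence min: "is_rat_min_poly x p"
    unfolding p_def using rootR by (rule is_rat_min_poly_rat_min_poly)
  have "p dvd map_poly of_int R" using is_rat_min_poly_dvd[OF min rootR] .
  then obtain g where "map_poly of_int R = p * g" by (auto simp: dvd_def)
  then obtain P where P: "p = map_poly of_int P" "lead_coeff P = 1" "P dvd R"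
    using monic_rat_factor_integral[of p R g] min deg by (auto simp: is_rat_min_poly_def)
  have "poly (map_poly of_int P) x = 0"
    using min unfolding is_rat_min_poly_def P(1) map_poly_of_rat_of_int by simp
  hence "poly (map_poly of_int P) (x ^ k) = 0"
    using P int_factor_root_power[of P n x k] n k by (simp add: R_def)
  hence "poly (map_poly of_rat p) (x ^ k) = 0"
    unfolding P(1) map_poly_of_rat_of_int .
  thus ?thesis using poly_of_rat_dvd is_rat_min_poly_dvd[OF min q] by blast
qed

section \<open>Roots of the cyclotomic polynomial\<close>

lemma exp_root_of_unity_power:
  "exp (2 * of_real pi * \<i> / of_nat n) ^ k = exp (2 * of_real pi * \<i> * of_nat k / of_nat n)"
  unfolding exp_of_nat_mult[symmetric] by (simp add: field_simps)

lemma exp_root_of_unity_power_eq_1_iff: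
  assumes "n > 0"
  shows "exp (2 * of_real pi * \<i> / of_nat n) ^ k = 1 \<longleftrightarrow> n dvd k"
  unfolding exp_root_of_unity_power using assms by (intro complex_root_unity_eq_1) simp

lemma root_of_unity_eq_power:
  assumes "n > 0" "z ^ n = (1 :: complex)"
  obtains k where "k < n" "z = exp (2 * of_real pi * \<i> / of_nat n) ^ k"
  using complex_roots_unity[of n] assms unfolding exp_root_of_unity_power by force

text \<open>The hypothesis says that \<open>y\<close> has order \<open>n\<close>, in the form that
  passes between conjugates. A power of the standard root with exponent \<open>k\<close> is already
  killed by n / gcd(k, n), so the gcd must be 1.\<close>

lemma primitive_root_eq_power:
  assumes n: "n > 0"
    and ord: "\<And>k. exp (2 * of_real pi * \<i> / of_nat n) ^ k = 1 \<longleftrightarrow> y ^ k = 1"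
  obtains k where "k < n" "coprime k n" "y = exp (2 * of_real pi * \<i> / of_nat n) ^ k"
proof -
  define \<zeta> where "\<zeta> = exp (2 * of_real pi * \<i> / of_nat n)"
  have one: "y ^ k = 1 \<longleftrightarrow> n dvd k" "\<zeta> ^ k = 1 \<longleftrightarrow> n dvd k" for k
    using ord[of k] exp_root_of_unity_power_eq_1_iff[OF n, of k] by (simp_all add: \<zeta>_def)
  have "y ^ n = 1" using one by simp
  then obtain k where k: "k < n" "y = \<zeta> ^ k"
    unfolding \<zeta>_def using root_of_unity_eq_power[OF n] by blast
  have "n dvd k * (n div gcd k n)"
    by (metis dvd_div_mult dvd_triv_right div_mult_swap gcd_dvd1 gcd_dvd2)
  hence "y ^ (n div gcd k n) = 1"
    unfolding k(2) by (simp add: one flip: power_mult)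
  hence "n dvd n div gcd k n" using one by simp
  hence "n \<le> n div gcd k n"
    using n by (intro dvd_imp_le) (auto simp: div_greater_zero_iff dvd_imp_le)
  hence "gcd k n = 1"
    using n by (metis div_less_dividend gcd_eq_0_iff less_one linorder_neqE_nat not_le nat_less_le)
  thus ?thesis using that k by (auto simp: coprime_iff_gcd_eq_1 \<zeta>_def)
qed

lemma poly_of_rat_monom_minus_1:
  "poly (map_poly of_rat (monom 1 k - 1)) x = x ^ k - (1 :: 'a :: field_char_0)"
proof -
  have "map_poly of_rat (monom 1 k - 1) = (monom 1 k - 1 :: 'a poly)"
    by (rule poly_eqI) (simp add: coeff_map_poly of_rat_diff)
  thus ?thesis by (simp add: poly_monom)
qed

lemma is_rat_min_poly_cyclotomic:
  assumes "n > 0"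
  shows "is_rat_min_poly (exp (2 * of_real pi * \<i> / of_nat n)) (cyclotomic_poly n)"
  unfolding cyclotomic_poly_def
proof (rule is_rat_min_poly_rat_min_poly)
  show "monom 1 n - 1 \<noteq> (0 :: rat poly)"
    using assms by (auto simp: poly_eq_iff intro!: exI[of _ n])
  show "poly (map_poly of_rat (monom 1 n - 1)) (exp (2 * of_real pi * \<i> / of_nat n)) = 0"
    using assms exp_root_of_unity_power_eq_1_iff[of n n] by (simp add: poly_of_rat_monom_minus_1)
qed

text \<open>For every root v, v^k = 1 holds exactly when the minimal polynomial divides X^k - 1;
  hence all roots have the same order. The converse is the conjugacy of coprime powers.\<close>

lemma cyclotomic_poly_roots:
  fixes n :: nat
  defines "\<zeta> \<equiv> exp (2 * of_real pi * \<i> / of_nat n)"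
  assumes n: "n > 0"
  shows "poly (map_poly of_rat (cyclotomic_poly n)) y = 0 \<longleftrightarrow> (\<exists>k<n. coprime k n \<and> y = \<zeta> ^ k)"
proof -
  have min: "is_rat_min_poly \<zeta> (cyclotomic_poly n)"
    unfolding \<zeta>_def using n by (rule is_rat_min_poly_cyclotomic)
  have one: "\<zeta> ^ k = 1 \<longleftrightarrow> n dvd k" for k
    unfolding \<zeta>_def using n by (rule exp_root_of_unity_power_eq_1_iff)
  have transfer: "\<zeta> ^ k = 1 \<longleftrightarrow> v ^ k = 1"
    if v: "poly (map_poly of_rat (cyclotomic_poly n)) v = 0" for v :: complex and k
  proof -
    have "is_rat_min_poly v (cyclotomic_poly n)" using is_rat_min_poly_root[OF min v] .
    hence "cyclotomic_poly n dvd monom 1 k - 1" if "v ^ k = 1"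
      using that by (intro is_rat_min_poly_dvd) (auto simp: poly_of_rat_monom_minus_1)
    moreover have "cyclotomic_poly n dvd monom 1 k - 1" if "\<zeta> ^ k = 1"
      using that min by (intro is_rat_min_poly_dvd[of \<zeta>]) (auto simp: poly_of_rat_monom_minus_1)
    moreover have "v ^ k = 1 \<and> \<zeta> ^ k = 1" if "cyclotomic_poly n dvd monom 1 k - 1"
      using poly_of_rat_dvd[OF that, of v] poly_of_rat_dvd[OF that, of \<zeta>] v min
      by (auto simp: poly_of_rat_monom_minus_1 is_rat_min_poly_def)
    ultimately show ?thesis by blast
  qed
  show ?thesis
  proof
    assume y: "poly (map_poly of_rat (cyclotomic_poly n)) y = 0"
    obtain k where "k < n" "coprime k n" "y = \<zeta> ^ k"
      using primitive_root_eq_power[OF n transfer[OF y, unfolded \<zeta>_def]] unfolding \<zeta>_def by blast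
    thus "\<exists>k<n. coprime k n \<and> y = \<zeta> ^ k" by blast
  next
    assume "\<exists>k<n. coprime k n \<and> y = \<zeta> ^ k"
    moreover have "\<zeta> ^ n = 1" using one by simp
    ultimately show "poly (map_poly of_rat (cyclotomic_poly n)) y = 0"
      using root_of_unity_power_conjugate[of \<zeta> n "cyclotomic_poly n"] min n
      by (auto simp: is_rat_min_poly_def)
  qed
qed

section \<open>Conjugates of \<open>2 cos (\<pi> / n)\<close>\<close>

text \<open>These are the rescaled Chebyshev polynomials 2 T_n(X/2). They turn z + 1/z into z^n +
  1/z^n.\<close>

fun vieta_lucas_poly :: "nat \<Rightarrow> rat poly" where
  "vieta_lucas_poly 0 = [:2:]"
| "vieta_lucas_poly (Suc 0) = [:0, 1:]"
| "vieta_lucas_poly (Suc (Suc n)) = [:0, 1:] * vieta_lucas_poly (Suc n) - vieta_lucas_poly n"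

lemma poly_vieta_lucas:
  fixes z :: "'a :: field_char_0"
  assumes "z \<noteq> 0"
  shows "poly (map_poly of_rat (vieta_lucas_poly n)) (z + inverse z) = z ^ n + inverse z ^ n"
proof (induction n rule: vieta_lucas_poly.induct)
  case (3 n)
  have "poly (map_poly of_rat (vieta_lucas_poly (Suc (Suc n)))) (z + inverse z) =
     (z + inverse z) * (z ^ Suc n + inverse z ^ Suc n) - (z ^ n + inverse z ^ n)"
    using 3 by (simp add: map_poly_of_rat_diff map_poly_of_rat_mult map_poly_pCons)
  also have "\<dots> = z ^ Suc (Suc n) + inverse z ^ Suc (Suc n) + (z * inverse z - 1) * (z ^ n + inverse z ^ n)"
    by (simp add: algebra_simps)
  finally show ?case using assms by simp
qed (auto simp: map_poly_pCons)

lemma add_inverse_eq_2_iff: "z + inverse z = 2 \<longleftrightarrow> z = (1 :: 'a :: field_char_0)"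
proof
  assume eq: "z + inverse z = 2"
  hence "z \<noteq> 0" by auto
  hence "(z - 1) ^ 2 = z * (z + inverse z - 2)" by (simp add: power2_eq_square algebra_simps)
  with eq show "z = 1" by simp
qed simp

text \<open>V_n - 2 does for z + 1/z what X^n - 1 does for z: it tests z^n = 1 by a rational
  polynomial.\<close>

lemma poly_vieta_lucas_minus_2:
  fixes z :: "'a :: field_char_0"
  assumes "z \<noteq> 0"
  shows "poly (map_poly of_rat (vieta_lucas_poly n - [:2:])) (z + inverse z) = 0 \<longleftrightarrow> z ^ n = 1"
  using poly_vieta_lucas[OF assms, of n] add_inverse_eq_2_iff[of "z ^ n"]
  by (simp add: map_poly_of_rat_diff map_poly_pCons power_inverse)

text \<open>\<open>z\<close> is a root of Z^2 - y Z + 1; the other root is \<open>y - z\<close>, and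
  their product is 1.\<close>

lemma eq_add_inverse:
  fixes y :: complex
  obtains z where "z \<noteq> 0" "y = z + inverse z"
proof -
  define z where "z = (y + csqrt (y\<^sup>2 - 4)) / 2"
  have "z * (y - z) = (y\<^sup>2 - (csqrt (y\<^sup>2 - 4))\<^sup>2) / 4"
    unfolding z_def by (simp add: field_simps power2_eq_square)
  hence 1: "z * (y - z) = 1" by simp
  hence "z \<noteq> 0" by auto
  moreover from 1 have "inverse z = y - z" by (metis inverse_unique)
  ultimately show ?thesis using that[of z] by simp
qed

text \<open>Any root is some z + 1/z, and divisibility of V_k - 2 by \<open>C\<close> shows that z
  has the same order as \<open>\<omega>\<close>. The converse reduces to powers of
  \<open>\<omega>\<close> itself.\<close>

lemma min_poly_root_plus_inverse_roots:
  fixes N :: nat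
  defines "\<omega> \<equiv> exp (2 * of_real pi * \<i> / of_nat N)"
  assumes N: "N > 0" and min: "is_rat_min_poly (\<omega> + inverse \<omega>) C"
  shows "poly (map_poly of_rat C) y = 0 \<longleftrightarrow>
    (\<exists>k<N. coprime k N \<and> y = \<omega> ^ k + inverse (\<omega> ^ k))"
proof -
  have one: "\<omega> ^ k = 1 \<longleftrightarrow> N dvd k" for k
    unfolding \<omega>_def using N by (rule exp_root_of_unity_power_eq_1_iff)
  have \<omega>0: "\<omega> \<noteq> 0" by (simp add: \<omega>_def)
  have transfer: "\<omega> ^ k = 1 \<longleftrightarrow> z ^ k = 1"
    if z: "z \<noteq> 0" "poly (map_poly of_rat C) (z + inverse z) = 0" for z :: complex and k
  proof -
    have minz: "is_rat_min_poly (z + inverse z) C" using is_rat_min_poly_root[OF min z(2)] .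
    have "v ^ k = 1 \<longleftrightarrow> C dvd vieta_lucas_poly k - [:2:]"
      if v: "v \<noteq> 0" "is_rat_min_poly (v + inverse v) C" for v :: complex
    proof
      assume "v ^ k = 1"
      thus "C dvd vieta_lucas_poly k - [:2:]"
        by (intro is_rat_min_poly_dvd[OF v(2)]) (simp only: poly_vieta_lucas_minus_2[OF v(1)])
    next
      assume dvd: "C dvd vieta_lucas_poly k - [:2:]"
      have "poly (map_poly of_rat C) (v + inverse v) = 0"
        using v(2) unfolding is_rat_min_poly_def by blast
      from poly_of_rat_dvd[OF dvd this] show "v ^ k = 1"
        by (simp only: poly_vieta_lucas_minus_2[OF v(1)])
    qed
    from this[OF \<omega>0 min] this[OF z(1) minz] show ?thesis by simp
  qed
  show ?thesis
  proof
    assume y: "poly (map_poly of_rat C) y = 0"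
    obtain z where z: "z \<noteq> 0" "y = z + inverse z" by (rule eq_add_inverse[of y])
    have tr: "\<omega> ^ k = 1 \<longleftrightarrow> z ^ k = 1" for k
      using transfer[OF z(1) y[unfolded z(2)]] .
    obtain k where "k < N" "coprime k N" "z = \<omega> ^ k"
      by (rule primitive_root_eq_power[OF N, of z, folded \<omega>_def, OF tr])
    thus "\<exists>k<N. coprime k N \<and> y = \<omega> ^ k + inverse (\<omega> ^ k)" using z(2) by auto
  next
    assume "\<exists>k<N. coprime k N \<and> y = \<omega> ^ k + inverse (\<omega> ^ k)"
    then obtain k where k: "k < N" "coprime k N" "y = \<omega> ^ k + inverse (\<omega> ^ k)"
      by (elim exE conjE)
    \<comment> \<open>On \<open>N\<close>-th roots of unity v^(N-1) is 1/v, so \<open>g\<close>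
      expresses v + 1/v as a polynomial in v, and \<open>C\<close> composed with \<open>g\<close>
      vanishes at \<open>\<omega>\<close>.\<close>
    define g where "g = (monom 1 1 + monom 1 (N - 1) :: rat poly)"
    have g: "poly (map_poly of_rat g) v = v + inverse v" if "v ^ N = 1" for v :: complex
    proof -
      have "v * v ^ (N - 1) = 1" using that power_minus_mult[OF N, of v] by (simp add: mult.commute)
      hence "inverse v = v ^ (N - 1)" by (rule inverse_unique)
      moreover have "map_poly of_rat g = (monom 1 1 + monom 1 (N - 1) :: complex poly)"
        unfolding g_def map_poly_of_rat_add by (simp add: map_poly_monom)
      ultimately show ?thesis by (simp only: poly_add poly_monom mult_1 power_one_right)
    qed
    have \<omega>N: "\<omega> ^ N = 1" using one by simp
    have "poly (map_poly of_rat (pcompose C g)) \<omega> = 0"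
      using min by (simp add: poly_of_rat_pcompose g[OF \<omega>N] is_rat_min_poly_def)
    hence "poly (map_poly of_rat (pcompose C g)) (\<omega> ^ k) = 0"
      by (rule root_of_unity_power_conjugate[OF \<omega>N N _ k(2)])
    moreover have "(\<omega> ^ k) ^ N = 1" using \<omega>N by (simp add: power_mult[symmetric] mult.commute[of k])
      (simp add: power_mult)
    ultimately show "poly (map_poly of_rat C) y = 0"
      by (simp add: poly_of_rat_pcompose g k(3))
  qed
qed

lemma exp_add_inverse_eq_cos:
  "exp (2 * of_real pi * \<i> / of_nat (2 * n)) ^ k + inverse (exp (2 * of_real pi * \<i> / of_nat (2 * n)) ^ k) =
     of_real (2 * cos (pi * real k / real n))"
proof -
  have "exp (2 * of_real pi * \<i> / of_nat (2 * n)) ^ k = cis (pi * real k / real n)"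
    unfolding exp_root_of_unity_power cis_conv_exp by (simp add: algebra_simps)
  thus ?thesis by (simp add: complex_eq_iff cis.code)
qed

lemma is_rat_min_poly_cos:
  assumes "n > 0"
  shows "is_rat_min_poly (exp (2 * of_real pi * \<i> / of_nat (2 * n)) +
     inverse (exp (2 * of_real pi * \<i> / of_nat (2 * n)))) (cos_min_poly n)"
proof -
  define \<omega> where "\<omega> = exp (2 * of_real pi * \<i> / of_nat (2 * n))"
  define V where "V = vieta_lucas_poly (2 * n) - [:2:]"
  have \<omega>: "\<omega> + inverse \<omega> = of_real (2 * cos (pi / real n))"
    using exp_add_inverse_eq_cos[of n 1] by (simp add: \<omega>_def)
  have "\<omega> ^ (2 * n) = 1"
    unfolding \<omega>_def using assms exp_root_of_unity_power_eq_1_iff[of "2 * n" "2 * n"] by simp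
  hence "poly (map_poly of_rat V) (\<omega> + inverse \<omega>) = 0"
    unfolding V_def by (subst poly_vieta_lucas_minus_2) (simp_all add: \<omega>_def)
  hence root: "poly (map_poly of_rat V) (2 * cos (pi / real n)) = 0"
    unfolding \<omega> poly_of_rat_of_real by simp
  \<comment> \<open>At z = 2, which is not a root of unity, \<open>V\<close> takes a nonzero value
    at 2 + 1/2; so \<open>V\<close> is a legitimate annihilating polynomial.\<close>
  have "(2 :: complex) ^ (2 * n) \<noteq> 1"
    using assms one_less_power[of "2::real" "2 * n"] by (metis less_irrefl mult_pos_pos norm_numeral norm_one norm_power one_less_numeral_iff semiring_norm(76) zero_less_numeral)
  hence "V \<noteq> 0"
    using poly_vieta_lucas_minus_2[of "2::complex" "2 * n"] unfolding V_def by auto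
  hence "is_rat_min_poly (2 * cos (pi / real n)) (cos_min_poly n)"
    unfolding cos_min_poly_def using root by (rule is_rat_min_poly_rat_min_poly)
  \<comment> \<open>\<open>cos_min_poly\<close> is defined over the reals; vanishing at the complex
    image makes it minimal there too.\<close>
  moreover from this have "poly (map_poly of_rat (cos_min_poly n)) (\<omega> + inverse \<omega>) = 0"
    unfolding \<omega> poly_of_rat_of_real by (simp add: is_rat_min_poly_def)
  ultimately show ?thesis
    unfolding \<omega>_def by (rule is_rat_min_poly_root)
qed

lemma cos_min_poly_roots:
  fixes y :: complex
  assumes n: "n \<ge> 2"
  shows "poly (map_poly of_rat (cos_min_poly n)) y = 0 \<longleftrightarrow>
    (\<exists>k. 1 \<le> k \<and> k \<le> n - 1 \<and> coprime k (2 * n) \<and> y = of_real (2 * cos (pi * real k / real n)))"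
proof -
  have "poly (map_poly of_rat (cos_min_poly n)) y = 0 \<longleftrightarrow>
      (\<exists>k<2 * n. coprime k (2 * n) \<and> y = of_real (2 * cos (pi * real k / real n)))"
    using min_poly_root_plus_inverse_roots[of "2 * n" "cos_min_poly n" y] is_rat_min_poly_cos[of n] n
    unfolding exp_add_inverse_eq_cos by simp
  also have "\<dots> \<longleftrightarrow> (\<exists>k. 1 \<le> k \<and> k \<le> n - 1 \<and> coprime k (2 * n) \<and> y = of_real (2 * cos (pi * real k / real n)))"
  proof
    assume "\<exists>k<2 * n. coprime k (2 * n) \<and> y = of_real (2 * cos (pi * real k / real n))"
    then obtain k where k: "k < 2 * n" "coprime k (2 * n)" "y = of_real (2 * cos (pi * real k / real n))" by blast
    have "k \<noteq> 0" using k(2) n by (intro notI) simp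
    moreover have "k \<noteq> n" using k(2) n by (intro notI) simp
    ultimately have "k \<noteq> 0" "k \<noteq> n" by blast+
    show "\<exists>k. 1 \<le> k \<and> k \<le> n - 1 \<and> coprime k (2 * n) \<and> y = of_real (2 * cos (pi * real k / real n))"
    proof (cases "k < n")
      case True
      thus ?thesis using k \<open>k \<noteq> 0\<close> by (intro exI[of _ k]) auto
    next
      case False
      \<comment> \<open>The exponents \<open>k\<close> and \<open>2 * n - k\<close> give the same
        cosine, so the upper half of the range folds onto the lower.\<close>
      have "pi * real (2 * n - k) / real n = 2 * pi - pi * real k / real n"
        using k(1) n by (simp add: of_nat_diff field_simps)
      hence "cos (pi * real (2 * n - k) / real n) = cos (pi * real k / real n)"
        by (simp add: cos_diff)
      moreover have "coprime (2 * n - k) (2 * n)"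
        using k(1,2) gcd_diff2_nat[of k "2 * n"] by (simp add: coprime_iff_gcd_eq_1)
      ultimately show ?thesis
        using k False \<open>k \<noteq> n\<close> by (intro exI[of _ "2 * n - k"]) auto
    qed
  next
    assume "\<exists>k. 1 \<le> k \<and> k \<le> n - 1 \<and> coprime k (2 * n) \<and> y = of_real (2 * cos (pi * real k / real n))"
    thus "\<exists>k<2 * n. coprime k (2 * n) \<and> y = of_real (2 * cos (pi * real k / real n))"
      using n by (elim exE conjE) (rule exI, auto)
  qed
  finally show ?thesis .
qed

section \<open>Product formulas over the conjugates\<close>

lemma poly_cyclotomic_poly:
  assumes n: "n \<ge> 2"
  shows "poly (map_poly of_rat (cyclotomic_poly n)) x =
    (\<Prod>k | 1 \<le> k \<and> k \<le> n - 1 \<and> coprime k n. x - exp (2 * of_real pi * \<i> * of_nat k / of_nat n))"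
proof -
  let ?z = "\<lambda>k. exp (2 * of_real pi * \<i> * of_nat k / of_nat n)"
  let ?K = "{k. 1 \<le> k \<and> k \<le> n - 1 \<and> coprime k n}"
  have K: "?K = {k. k < n \<and> coprime k n}"
  proof (intro Collect_cong)
    fix k
    have "k \<noteq> 0" if "coprime k n" using that n by (intro notI) simp
    thus "1 \<le> k \<and> k \<le> n - 1 \<and> coprime k n \<longleftrightarrow> k < n \<and> coprime k n"
      using n by auto
  qed
  have roots: "{z. poly (map_poly of_rat (cyclotomic_poly n)) z = 0} = ?z ` ?K"
    unfolding K using cyclotomic_poly_roots[of n] n by (auto simp: exp_root_of_unity_power)
  have inj: "inj_on ?z ?K"
    unfolding K using n by (auto simp: inj_on_def complex_root_unity_eq)
  show ?thesis
    using is_rat_min_poly_prod_roots[OF is_rat_min_poly_cyclotomic[of n]] n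
    unfolding roots prod.reindex[OF inj] by (simp add: poly_prod)
qed

lemma poly_cos_min_poly:
  fixes x :: complex
  assumes n: "n \<ge> 2"
  shows "poly (map_poly of_rat (cos_min_poly n)) x =
    (\<Prod>k | 1 \<le> k \<and> k \<le> n - 1 \<and> coprime k (2 * n). x - of_real (2 * cos (pi * real k / real n)))"
proof -
  let ?c = "\<lambda>k. complex_of_real (2 * cos (pi * real k / real n))"
  let ?K = "{k. 1 \<le> k \<and> k \<le> n - 1 \<and> coprime k (2 * n)}"
  have roots: "{z. poly (map_poly of_rat (cos_min_poly n)) z = 0} = ?c ` ?K"
    using cos_min_poly_roots[OF n] by auto
  have inj: "inj_on ?c ?K"
  proof (rule inj_onI)
    fix i j assume ij: "i \<in> ?K" "j \<in> ?K" "?c i = ?c j"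
    \<comment> \<open>After folding, all angles lie in [0, pi], where the cosine is injective, so no
      conjugate is counted twice.\<close>
    have range: "pi * real k / real n \<in> {0..pi}" if "k \<in> ?K" for k
      using that n by (auto simp: field_simps)
    have "cos (pi * real i / real n) = cos (pi * real j / real n)"
      using ij(3) by (simp only: of_real_eq_iff)
    hence "pi * real i / real n = pi * real j / real n"
      using range[OF ij(1)] range[OF ij(2)]
      by (intro cos_inj_pi[of "pi * real i / real n" "pi * real j / real n"]) (simp_all only: atLeastAtMost_iff)
    thus "i = j" using n by simp
  qed
  show ?thesis
    using is_rat_min_poly_prod_roots[OF is_rat_min_poly_cos[of n]] n
    unfolding roots prod.reindex[OF inj] by (simp add: poly_prod)
qed

section \<open>Values at \<open>0\<close> and \<open>-1\<close>\<close>

lemma card_coprime_range_eq_totient: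
  assumes "n \<ge> 2"
  shows "card {k. 1 \<le> k \<and> k \<le> n - 1 \<and> coprime k n} = totient n"
proof -
  have "k \<noteq> n" if "coprime k n" for k
    using that assms by auto
  hence "{k. 1 \<le> k \<and> k \<le> n - 1 \<and> coprime k n} = totatives n"
    using assms by (force simp: totatives_def)
  thus ?thesis by (simp add: totient_def)
qed

text \<open>The involution sending k to n - k preserves coprimality to \<open>n\<close> and pairs
  terms with sum \<open>n\<close>.\<close>

lemma sum_coprime_range:
  assumes "n \<ge> 2"
  shows "2 * (\<Sum>k | 1 \<le> k \<and> k \<le> n - 1 \<and> coprime k n. real k) = real n * real (totient n)"
proof -
  let ?K = "{k. 1 \<le> k \<and> k \<le> n - 1 \<and> coprime k n}"
  have cop: "coprime (n - k) n" if "coprime k n" "k \<le> n" for k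
    using that by (metis coprime_iff_gcd_eq_1 gcd.commute gcd_diff2_nat)
  have "(\<Sum>k\<in>?K. real k) = (\<Sum>k\<in>?K. real (n - k))"
    by (rule sum.reindex_bij_witness[of _ "\<lambda>k. n - k" "\<lambda>k. n - k"]) (use assms cop in auto)
  hence "2 * (\<Sum>k\<in>?K. real k) = (\<Sum>k\<in>?K. real k + real (n - k))"
    by (simp add: sum.distrib)
  also have "\<dots> = (\<Sum>k\<in>?K. real n)"
    by (intro sum.cong) auto
  finally show ?thesis using card_coprime_range_eq_totient[OF assms] by simp
qed

lemma cyclotomic_sylvester_i:
  assumes "n \<ge> 2"
  shows "cyclotomic_sylvester \<i> (- \<i>) n =
    \<i> ^ totient n * (\<Prod>k | 1 \<le> k \<and> k \<le> n - 1 \<and> coprime k n. 1 + exp (2 * of_real pi * \<i> * of_nat k / of_nat n))"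
proof -
  have "cyclotomic_sylvester \<i> (- \<i>) n =
    (\<Prod>k | 1 \<le> k \<and> k \<le> n - 1 \<and> coprime k n. \<i> * (1 + exp (2 * of_real pi * \<i> * of_nat k / of_nat n)))"
    unfolding cyclotomic_sylvester_def by (simp add: algebra_simps)
  thus ?thesis
    using card_coprime_range_eq_totient[OF assms] by (simp add: prod.distrib)
qed

text \<open>
  Since \<open>-2 cos \<theta> = cis (\<pi> - \<theta>) (1 + cis (2 \<theta>))\<close>, only the phases \<open>cis (\<pi> - \<pi> k / n)\<close> remain; they
  multiply to \<open>\<i>\<close> to the power \<open>\<phi>(n)\<close> because the residues coprime to \<open>n\<close> have mean \<open>n / 2\<close>.
\<close>

lemma poly_cos_min_poly_0:
  assumes n: "n \<ge> 2" "even n"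
  shows "poly (map_poly of_rat (cos_min_poly n)) 0 = cyclotomic_sylvester \<i> (- \<i>) n"
proof -
  let ?K = "{k. 1 \<le> k \<and> k \<le> n - 1 \<and> coprime k n}"
  let ?z = "\<lambda>k. exp (2 * of_real pi * \<i> * of_nat k / of_nat n)"
  have "coprime k (2 * n) \<longleftrightarrow> coprime k n" for k
    using n(2) by (auto simp: coprime_mult_right_iff elim!: evenE)
  hence "poly (map_poly of_rat (cos_min_poly n)) 0 =
      (\<Prod>k\<in>?K. - complex_of_real (2 * cos (pi * real k / real n)))"
    using poly_cos_min_poly[OF n(1), of 0] by simp
  also have "\<dots> = (\<Prod>k\<in>?K. cis (pi - pi * real k / real n) * (1 + ?z k))"
  proof (rule prod.cong[OF refl])
    fix k
    define t where "t = pi * real k / real n"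
    have "?z k = cis (2 * t)"
      unfolding t_def cis_conv_exp by (simp add: algebra_simps)
    hence "cis (pi - t) * (1 + ?z k) = cis (pi - t) + cis (pi + t)"
      by (simp add: distrib_left cis_mult add.commute)
    also have "\<dots> = - complex_of_real (2 * cos t)"
      by (simp add: complex_eq_iff cos_diff cos_add sin_diff sin_add)
    finally show "- complex_of_real (2 * cos (pi * real k / real n)) =
        cis (pi - pi * real k / real n) * (1 + ?z k)" by (simp add: t_def)
  qed
  also have "\<dots> = (\<Prod>k\<in>?K. cis (pi - pi * real k / real n)) * (\<Prod>k\<in>?K. 1 + ?z k)"
    by (rule prod.distrib)
  also have "(\<Prod>k\<in>?K. cis (pi - pi * real k / real n)) = cis (\<Sum>k\<in>?K. pi - pi * real k / real n)"
    by (simp add: cis_conv_exp exp_sum sum_distrib_left)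
  also have "(\<Sum>k\<in>?K. pi - pi * real k / real n) = real (totient n) * pi - pi / real n * (\<Sum>k\<in>?K. real k)"
    using card_coprime_range_eq_totient[OF n(1)] by (simp add: sum_subtractf sum_distrib_left)
  also have "\<dots> = real (totient n) * (pi / 2)"
    using sum_coprime_range[OF n(1)] n(1) by (simp add: field_simps)
  also have "cis \<dots> = \<i> ^ totient n"
    by (simp only: Complex.DeMoivre[symmetric] cis_pi_half)
  finally show ?thesis using cyclotomic_sylvester_i[OF n(1)] by simp
qed

lemma sylvester_eq_cyclotomic_poly:
  assumes "n \<ge> 2"
  shows "cyclotomic_sylvester \<i> (- \<i>) n =
    (- 1) powr (of_nat (totient n) + of_nat (totient n) / 2) * of_rat (poly (cyclotomic_poly n) (- 1))"
proof -
  let ?K = "{k. 1 \<le> k \<and> k \<le> n - 1 \<and> coprime k n}"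
  let ?z = "\<lambda>k. exp (2 * of_real pi * \<i> * of_nat k / of_nat n)"
  have "of_rat (poly (cyclotomic_poly n) (- 1)) = (\<Prod>k\<in>?K. (- 1) * (1 + ?z k))"
    using poly_cyclotomic_poly[OF assms, of "- 1"] poly_of_rat_of_rat[of "cyclotomic_poly n" "- 1", where 'a = complex]
    by (simp add: of_rat_minus)
  also have "\<dots> = (- 1) ^ totient n * (\<Prod>k\<in>?K. 1 + ?z k)"
    unfolding prod.distrib using card_coprime_range_eq_totient[OF assms] by simp
  finally have cyc: "of_rat (poly (cyclotomic_poly n) (- 1)) = (- 1) ^ totient n * (\<Prod>k\<in>?K. 1 + ?z k)" .
  \<comment> \<open>The principal logarithm of -1 is i pi. Computing through \<open>exp\<close> also
    covers the half-integral exponent for \<open>n = 2\<close>, where the totient is 1.\<close>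
  have "(- 1 :: complex) powr (of_nat (totient n) / 2) = exp (of_nat (totient n) * (\<i> * of_real pi / 2))"
    by (simp add: powr_def)
  also have "\<dots> = \<i> ^ totient n"
    unfolding exp_of_nat_mult using cis_conv_exp[of "pi / 2"] by simp
  finally have "(- 1 :: complex) powr (of_nat (totient n) + of_nat (totient n) / 2) = (- 1) ^ totient n * \<i> ^ totient n"
    unfolding powr_add by (simp add: neg_one_powr_of_nat)
  thus ?thesis
    unfolding cyc cyclotomic_sylvester_i[OF assms] by (simp flip: power_mult_distrib power_add mult_2)
qed

theorem proposition6:
  fixes m :: nat
  assumes "m \<ge> 1"
  shows "of_rat (poly (cos_min_poly (2 * m)) 0) =
           (-1 :: complex) powr (of_nat (totient (4 * m)) / 2 + of_nat (totient (2 * m))) *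
             cyclotomic_sylvester \<i> (- \<i>) (2 * m) \<and>
         (-1 :: complex) powr (of_nat (totient (4 * m)) / 2 + of_nat (totient (2 * m))) *
             cyclotomic_sylvester \<i> (- \<i>) (2 * m) =
           (-1 :: complex) powr (of_nat (totient (4 * m)) / 2 + of_nat (totient (2 * m)) / 2) *
             of_rat (poly (cyclotomic_poly (2 * m)) (- 1))"
proof -
  \<comment> \<open>Since \<open>2 * m\<close> is even, doubling it doubles the totient. The
    exponent in front of the Sylvester number becomes 2 \<open>totient (2 * m)\<close>, so that sign
    is 1; the other exponent takes the form in \<open>sylvester_eq_cyclotomic_poly\<close>.\<close>
  have "totient (4 * m) = 2 * totient (2 * m)"
    using totient_double[of "2 * m"] by simp
  hence half: "of_nat (totient (4 * m)) / 2 = (of_nat (totient (2 * m)) :: complex)" by simp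
  have "(- 1 :: complex) powr (of_nat (totient (2 * m)) + of_nat (totient (2 * m))) = 1"
    using neg_one_powr_of_nat[of "totient (2 * m) + totient (2 * m)"] by simp
  moreover have "of_rat (poly (cos_min_poly (2 * m)) 0) = cyclotomic_sylvester \<i> (- \<i>) (2 * m)"
    using poly_cos_min_poly_0[of "2 * m"] poly_of_rat_of_rat[of "cos_min_poly (2 * m)" 0, where 'a = complex] assms
    by simp
  ultimately show ?thesis
    using sylvester_eq_cyclotomic_poly[of "2 * m"] assms unfolding half by simp
qed

end
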